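(* Let $\varphi : R \to S$ be a homomorphism of commutative rings, let $L$ be a finitely presented $R$-module, and let $M$ be an $S$-module. Then \[ \mathrm{sK}_S\bigl(\mathrm{Hom}_R(L, M)\bigr) = (\varphi^* )^{-1}(\mathrm{Supp}_R L) \cap \mathrm{sK}_S(M). \]
   Context: All rings are commutative with unity and not necessarily Noetherian. For a ring $A$ and an $A$-module $N$, the set $\mathrm{sK}_A(N)$ of strong Krull primes of $N$ is the set of all $\mathfrak{p} \in \mathrm{Spec}\, A$ such that for every finitely generated ideal $I$ of $A$ with $I \subseteq \mathfrak{p}$ there is an element $z \in N$ with $I \subseteq \mathrm{ann}_A(z) \subseteq \mathfrak{p}$. $\varphi^* : \mathrm{Spec}\, S \to \mathrm{Spec}\, R$ denotes the induced map $P \mapsto \varphi^{-1}(P)$. $\mathrm{Supp}_R L = \{\mathfrak{p} \in \mathrm{Spec}\, R \mid L_{\mathfrak{p}} \neq 0\}$. $M$ is regarded as an $R$-module via $\varphi$, and $\mathrm{Hom}_R(L, M)$ is an $S$-module via the action of $S$ on $M$. *)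

theory Defs
  imports "HOL-Algebra.RingHom" "HOL-Algebra.Module"
begin

section \<open>Prime spectrum\<close>

definition Spec :: "('a, 'x) ring_scheme \<Rightarrow> 'a set set" where
  "Spec R = {p. primeideal p R}"

definition Spec_map :: "('a, 'x) ring_scheme \<Rightarrow> ('a \<Rightarrow> 'b) \<Rightarrow> 'b set \<Rightarrow> 'a set" where
  "Spec_map R \<phi> P = {r \<in> carrier R. \<phi> r \<in> P}"

section \<open>Strong Krull primes\<close>

definition fin_gen_ideal :: "('a, 'x) ring_scheme \<Rightarrow> 'a set \<Rightarrow> bool" where
  "fin_gen_ideal R I \<longleftrightarrow> (\<exists>X. finite X \<and> X \<subseteq> carrier R \<and> I = Idl\<^bsub>R\<^esub> X)"

definition ann :: "('a, 'x) ring_scheme \<Rightarrow> ('a, 'm, 'y) module_scheme \<Rightarrow> 'm \<Rightarrow> 'a set" where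
  "ann R N z = {a \<in> carrier R. a \<odot>\<^bsub>N\<^esub> z = \<zero>\<^bsub>N\<^esub>}"

definition sK :: "('a, 'x) ring_scheme \<Rightarrow> ('a, 'm, 'y) module_scheme \<Rightarrow> 'a set set" where
  "sK R N = {p \<in> Spec R. \<forall>I. fin_gen_ideal R I \<and> I \<subseteq> p \<longrightarrow>
     (\<exists>z \<in> carrier N. I \<subseteq> ann R N z \<and> ann R N z \<subseteq> p)}"

section \<open>Module homomorphisms\<close>

text \<open>
  A record of type \<open>module\<close> inherits the fields \<open>mult\<close> and \<open>one\<close> from \<open>ring\<close>.  They play
  no part in the locale \<open>module\<close>; below they are copied from an argument or left undefined.

  Homomorphisms are extensional functions on the carrier, so that equality in
  the Hom module is equality of functions.
\<close>

definition module_hom ::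
  "('a, 'x) ring_scheme \<Rightarrow> ('a, 'm, 'y) module_scheme \<Rightarrow> ('a, 'n, 'z) module_scheme \<Rightarrow> ('m \<Rightarrow> 'n) set"
where
  "module_hom R M N = {f \<in> carrier M \<rightarrow>\<^sub>E carrier N.
     (\<forall>x \<in> carrier M. \<forall>y \<in> carrier M. f (x \<oplus>\<^bsub>M\<^esub> y) = f x \<oplus>\<^bsub>N\<^esub> f y) \<and>
     (\<forall>r \<in> carrier R. \<forall>x \<in> carrier M. f (r \<odot>\<^bsub>M\<^esub> x) = r \<odot>\<^bsub>N\<^esub> f x)}"

definition restrict_scalars :: "('a \<Rightarrow> 'b) \<Rightarrow> ('b, 'm, 'y) module_scheme \<Rightarrow> ('a, 'm) module" where
  "restrict_scalars \<phi> M =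
    \<lparr>carrier = carrier M, mult = mult M, one = one M, zero = zero M, add = add M,
     smult = (\<lambda>r m. \<phi> r \<odot>\<^bsub>M\<^esub> m)\<rparr>"

text \<open>
  For \<open>\<phi> : R \<rightarrow> S\<close>, an \<open>R\<close>-module \<open>L\<close> and an \<open>S\<close>-module \<open>M\<close>, the \<open>S\<close>-module of
  \<open>R\<close>-linear maps from \<open>L\<close> to \<open>M\<close>.
\<close>

definition Hom_module ::
  "('a, 'x) ring_scheme \<Rightarrow> ('a \<Rightarrow> 'b) \<Rightarrow> ('a, 'l, 'y) module_scheme \<Rightarrow> ('b, 'm, 'z) module_scheme
    \<Rightarrow> ('b, 'l \<Rightarrow> 'm) module"
where
  "Hom_module R \<phi> L M =
    \<lparr>carrier = module_hom R L (restrict_scalars \<phi> M), mult = undefined, one = undefined,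
     zero = (\<lambda>x \<in> carrier L. \<zero>\<^bsub>M\<^esub>),
     add = (\<lambda>f g. \<lambda>x \<in> carrier L. f x \<oplus>\<^bsub>M\<^esub> g x),
     smult = (\<lambda>s f. \<lambda>x \<in> carrier L. s \<odot>\<^bsub>M\<^esub> f x)\<rparr>"

section \<open>Finitely presented modules\<close>

definition free_module :: "('a, 'x) ring_scheme \<Rightarrow> nat \<Rightarrow> ('a, nat \<Rightarrow> 'a) module" where
  "free_module R n =
    \<lparr>carrier = {..<n} \<rightarrow>\<^sub>E carrier R, mult = undefined, one = undefined,
     zero = (\<lambda>i \<in> {..<n}. \<zero>\<^bsub>R\<^esub>),
     add = (\<lambda>v w. \<lambda>i \<in> {..<n}. v i \<oplus>\<^bsub>R\<^esub> w i),
     smult = (\<lambda>r v. \<lambda>i \<in> {..<n}. r \<otimes>\<^bsub>R\<^esub> v i)\<rparr>"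

definition gen_submodule ::
  "('a, 'x) ring_scheme \<Rightarrow> ('a, 'm, 'y) module_scheme \<Rightarrow> 'm set \<Rightarrow> 'm set"
where
  "gen_submodule R M X = \<Inter>{H. submodule H R M \<and> X \<subseteq> H}"

definition fin_gen_submodule ::
  "('a, 'x) ring_scheme \<Rightarrow> ('a, 'm, 'y) module_scheme \<Rightarrow> 'm set \<Rightarrow> bool"
where
  "fin_gen_submodule R M H \<longleftrightarrow>
    (\<exists>X. finite X \<and> X \<subseteq> carrier M \<and> H = gen_submodule R M X)"

definition fin_presented :: "('a, 'x) ring_scheme \<Rightarrow> ('a, 'm, 'y) module_scheme \<Rightarrow> bool" where
  "fin_presented R L \<longleftrightarrow>
    (\<exists>n. \<exists>f \<in> module_hom R (free_module R n) L.
       f ` carrier (free_module R n) = carrier L \<and>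
       fin_gen_submodule R (free_module R n) {v \<in> carrier (free_module R n). f v = \<zero>\<^bsub>L\<^esub>})"

section \<open>Localization and support\<close>

definition frac_rel ::
  "('a, 'x) ring_scheme \<Rightarrow> ('a, 'm, 'y) module_scheme \<Rightarrow> 'a set \<Rightarrow> (('m \<times> 'a) \<times> ('m \<times> 'a)) set"
where
  "frac_rel R L T = {((x, s), (y, t)).
     x \<in> carrier L \<and> y \<in> carrier L \<and> s \<in> T \<and> t \<in> T \<and>
     (\<exists>u \<in> T. u \<odot>\<^bsub>L\<^esub> (t \<odot>\<^bsub>L\<^esub> x) = u \<odot>\<^bsub>L\<^esub> (s \<odot>\<^bsub>L\<^esub> y))}"

definition frac ::
  "('a, 'x) ring_scheme \<Rightarrow> ('a, 'm, 'y) module_scheme \<Rightarrow> 'a set \<Rightarrow> 'm \<Rightarrow> 'a \<Rightarrow> ('m \<times> 'a) set"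
where
  "frac R L T x s = frac_rel R L T `` {(x, s)}"

text \<open>
  The localization of \<open>L\<close> at the prime ideal \<open>p\<close>, consisting of the fractions \<open>x / s\<close> with
  \<open>s\<close> outside \<open>p\<close>, as an \<open>R\<close>-module.  The unions below have all their members equal, since
  the operations do not depend on the chosen representatives.
\<close>

definition localization ::
  "('a, 'x) ring_scheme \<Rightarrow> ('a, 'm, 'y) module_scheme \<Rightarrow> 'a set \<Rightarrow> ('a, ('m \<times> 'a) set) module"
where
  "localization R L p = (let T = carrier R - p in
    \<lparr>carrier = (carrier L \<times> T) // frac_rel R L T, mult = undefined, one = undefined,
     zero = frac R L T \<zero>\<^bsub>L\<^esub> \<one>\<^bsub>R\<^esub>,
     add = (\<lambda>X Y. \<Union>(x, s) \<in> X. \<Union>(y, t) \<in> Y.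
              frac R L T (t \<odot>\<^bsub>L\<^esub> x \<oplus>\<^bsub>L\<^esub> s \<odot>\<^bsub>L\<^esub> y) (s \<otimes>\<^bsub>R\<^esub> t)),
     smult = (\<lambda>r X. \<Union>(x, s) \<in> X. frac R L T (r \<odot>\<^bsub>L\<^esub> x) s)\<rparr>)"

definition Supp :: "('a, 'x) ring_scheme \<Rightarrow> ('a, 'm, 'y) module_scheme \<Rightarrow> 'a set set" where
  "Supp R L = {p \<in> Spec R. carrier (localization R L p) \<noteq> {\<zero>\<^bsub>localization R L p\<^esub>}}"

end

theory Submission
  imports Defs
begin

text \<open>
  Let \<open>p = \<phi>\<^sup>-\<^sup>1(P)\<close> and let \<open>L\<close> have generators \<open>x\<^sub>k\<close>.  For \<open>f : L \<rightarrow> M\<close> the annihilator of \<open>f\<close>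
  is the finite intersection of those of the \<open>f(x\<^sub>k)\<close>, so if it lies in \<open>P\<close> then so does the
  annihilator of some \<open>f(x\<^sub>k)\<close>.  This gives \<open>P \<in> sK(M)\<close>, and no \<open>u \<notin> p\<close> can kill \<open>x\<^sub>k\<close>, so
  \<open>L\<^sub>p \<noteq> 0\<close>.

  Conversely, if \<open>L\<^sub>p \<noteq> 0\<close>, then Nakayama's lemma and linear algebra over the domain \<open>R/p\<close> give a
  nonzero map \<open>L \<rightarrow> R/p\<close>, that is, a vector \<open>w \<in> R\<^sup>n\<close> with some entry outside \<open>p\<close> such that
  \<open>w \<bullet> a \<in> p\<close> for every relation \<open>a\<close> among the \<open>x\<^sub>k\<close>.  Given a finitely generated \<open>I \<subseteq> P\<close>, adjoin
  to \<open>I\<close> the elements \<open>\<phi>(w \<bullet> a)\<close> for the finitely many generating relations \<open>a\<close>, and take \<open>z \<in> M\<close>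
  with annihilator between this larger ideal and \<open>P\<close>.  Then \<open>x\<^sub>k \<mapsto> \<phi>(w\<^sub>k) z\<close> defines a homomorphism
  \<open>L \<rightarrow> M\<close> whose annihilator lies between \<open>I\<close> and \<open>P\<close>.
\<close>

section \<open>Functionals modulo a prime ideal\<close>

lemma (in primeideal) one_not_mem: "\<one> \<in> carrier R - I"
  using I_notcarr one_imp_carrier by auto

text \<open>
  Linear algebra over the domain \<open>R/I\<close> without forming it: a proper submodule of \<open>R\<^sup>n\<close> that
  contains \<open>I\<^sup>n\<close> and is saturated lies in the kernel of a nonzero functional modulo \<open>I\<close>.
  Vectors are total functions, so that \<open>N\<close> stays fixed while the bound \<open>n\<close> on their
  support varies in the induction.
\<close>

lemma (in primeideal) separating_functional:
  fixes N :: "(nat \<Rightarrow> 'a) set"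
  assumes carr: "N \<subseteq> UNIV \<rightarrow> carrier R"
    and lin: "\<And>a b r s. \<lbrakk>a \<in> N; b \<in> N; r \<in> carrier R; s \<in> carrier R\<rbrakk>
      \<Longrightarrow> (\<lambda>i. r \<otimes> a i \<oplus> s \<otimes> b i) \<in> N"
    and I_N: "UNIV \<rightarrow> I \<subseteq> N"
    and sat: "\<And>a u. \<lbrakk>a \<in> UNIV \<rightarrow> carrier R; u \<in> carrier R - I; (\<lambda>i. u \<otimes> a i) \<in> N\<rbrakk> \<Longrightarrow> a \<in> N"
    and v: "v \<in> UNIV \<rightarrow> carrier R" "\<forall>i\<ge>n. v i = \<zero>" "v \<notin> N"
  shows "\<exists>w \<in> UNIV \<rightarrow> carrier R. (\<exists>k<n. w k \<notin> I) \<and>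
    (\<forall>a\<in>N. (\<forall>i\<ge>n. a i = \<zero>) \<longrightarrow> (\<Oplus>i\<in>{..<n}. w i \<otimes> a i) \<in> I)"
  using v
proof (induction n arbitrary: v)
  case 0
  \<comment> \<open>With no coordinates left, \<open>v\<close> is the zero vector, whose entries lie
    in \<open>I\<close>; this contradicts \<open>v \<notin> N\<close>.\<close>
  then have "v \<in> N"
    using I_N by (intro subsetD[OF I_N]) auto
  then show ?case
    using 0(3) by simp
next
  case (Suc n)
  let ?supp = "\<lambda>n a. \<forall>i\<ge>n. a i = \<zero>"
  have Nc: "a i \<in> carrier R" if "a \<in> N" for a i
    using carr that by auto
  show ?case
  \<comment> \<open>Either the first \<open>n\<close> coordinates already carry a vector outside
    \<open>N\<close>, and the functional from the induction hypothesis has to be extended to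
    coordinate \<open>n\<close>, or they do not, and coordinate \<open>n\<close> itself
    separates.\<close>
  proof (cases "\<exists>v' \<in> UNIV \<rightarrow> carrier R. ?supp n v' \<and> v' \<notin> N")
    case True
    then obtain v' where "v' \<in> UNIV \<rightarrow> carrier R" "?supp n v'" "v' \<notin> N"
      by blast
    from Suc.IH[OF this] obtain w k where w: "w \<in> UNIV \<rightarrow> carrier R" and k: "k < n" "w k \<notin> I"
      and wN: "\<forall>a\<in>N. ?supp n a \<longrightarrow> (\<Oplus>i\<in>{..<n}. w i \<otimes> a i) \<in> I"
      by (elim bexE conjE exE)
    have wc: "w i \<in> carrier R" for i
      using w by auto
    show ?thesis
    proof (cases "\<exists>c\<in>N. ?supp (Suc n) c \<and> c n \<notin> I")
      case True
      then obtain c where c: "c \<in> N" "?supp (Suc n) c" "c n \<notin> I"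
        by blast
      have cc: "c i \<in> carrier R" for i
        using Nc c(1) by blast
      let ?s = "\<Oplus>i\<in>{..<n}. w i \<otimes> c i"
      have sc: "?s \<in> carrier R"
        using wc cc by auto
      \<comment> \<open>The extended functional must vanish on \<open>c\<close>, which forces the
        value \<open>- ?s / c n\<close> at coordinate \<open>n\<close>. Multiplying through by
        \<open>c n\<close> avoids the division, and \<open>?w k\<close> stays outside
        \<open>I\<close> because \<open>I\<close> is prime.\<close>
      let ?w = "\<lambda>i. if i = n then \<ominus> ?s else c n \<otimes> w i"
      have "?w \<in> UNIV \<rightarrow> carrier R"
        using wc cc sc by auto
      moreover have "?w k \<notin> I"
        using k c(3) I_prime cc wc by auto
      moreover have "(\<Oplus>i\<in>{..<Suc n}. ?w i \<otimes> a i) \<in> I" if a: "a \<in> N" "?supp (Suc n) a" for a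
      proof -
        have ac: "a i \<in> carrier R" for i
          using Nc a(1) by blast
        \<comment> \<open>Gaussian elimination against the pivot \<open>c n\<close>: coordinate
          \<open>n\<close> of \<open>?d\<close> cancels, so \<open>wN\<close> applies, and
          \<open>w\<close> evaluated on \<open>?d\<close> is exactly \<open>?w\<close> evaluated on
          \<open>a\<close>.\<close>
        let ?d = "\<lambda>i. c n \<otimes> a i \<oplus> (\<ominus> a n) \<otimes> c i"
        have "?d \<in> N"
          using a(1) c(1) ac cc by (intro lin) auto
        moreover have "?supp n ?d"
        proof (intro allI impI)
          fix i assume "n \<le> i"
          show "?d i = \<zero>"
          proof (cases "i = n")
            case True
            then show ?thesis
              using ac cc by (simp add: l_minus r_minus r_neg m_comm)
          next
            case False
            then have "Suc n \<le> i"
              using \<open>n \<le> i\<close> by simp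
            then show ?thesis
              using a(2) c(2) ac cc by simp
          qed
        qed
        ultimately have "(\<Oplus>i\<in>{..<n}. w i \<otimes> ?d i) \<in> I"
          by (rule wN[THEN bspec, THEN mp])
        also have "(\<Oplus>i\<in>{..<n}. w i \<otimes> ?d i) =
            (\<Oplus>i\<in>{..<n}. c n \<otimes> w i \<otimes> a i \<oplus> (\<ominus> a n) \<otimes> (w i \<otimes> c i))"
          using wc ac cc by (intro finsum_cong') (auto simp: r_distr m_ac)
        also have "\<dots> = (\<Oplus>i\<in>{..<n}. c n \<otimes> w i \<otimes> a i) \<oplus> (\<Oplus>i\<in>{..<n}. (\<ominus> a n) \<otimes> (w i \<otimes> c i))"
          using wc ac cc by (intro finsum_addf) auto
        also have "(\<Oplus>i\<in>{..<n}. (\<ominus> a n) \<otimes> (w i \<otimes> c i)) = (\<ominus> a n) \<otimes> ?s"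
          using wc ac cc by (subst finsum_rdistr) auto
        also have "\<dots> = (\<ominus> ?s) \<otimes> a n"
          using ac sc by (simp add: l_minus r_minus m_comm)
        also have "(\<Oplus>i\<in>{..<n}. c n \<otimes> w i \<otimes> a i) = (\<Oplus>i\<in>{..<n}. ?w i \<otimes> a i)"
          using wc ac cc by (intro finsum_cong') auto
        also have "\<dots> \<oplus> (\<ominus> ?s) \<otimes> a n = (\<Oplus>i\<in>{..<Suc n}. ?w i \<otimes> a i)"
        proof -
          have "(\<Oplus>i\<in>{..<n}. ?w i \<otimes> a i) \<in> carrier R"
            using wc ac cc sc by (intro finsum_closed) auto
          then show ?thesis
            using wc ac cc sc unfolding lessThan_Suc
            by (subst finsum_insert) (auto simp: a_comm)
        qed
        finally show ?thesis .
      qed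
      ultimately show ?thesis
        using k(1) by (intro bexI[of _ ?w] conjI exI[of _ k]) auto
    next
      case False
      \<comment> \<open>Without a pivot, every relevant \<open>a \<in> N\<close> has
        \<open>a n \<in> I\<close>. Its last coordinate can be subtracted inside \<open>N\<close>,
        because \<open>N\<close> contains all vectors over \<open>I\<close>, so extension by zero
        suffices.\<close>
      let ?w = "w(n := \<zero>)"
      have "(\<Oplus>i\<in>{..<Suc n}. ?w i \<otimes> a i) \<in> I" if a: "a \<in> N" "?supp (Suc n) a" for a
      proof -
        have ac: "a i \<in> carrier R" for i
          using Nc a(1) by blast
        have aI: "a n \<in> I"
          using False a by blast
        let ?b = "\<lambda>i. if i = n then a n else \<zero>"
        have "?b \<in> N"
          using aI I_N by auto
        then have "(\<lambda>i. \<one> \<otimes> a i \<oplus> (\<ominus> \<one>) \<otimes> ?b i) \<in> N"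
          using a(1) by (intro lin) auto
        also have "(\<lambda>i. \<one> \<otimes> a i \<oplus> (\<ominus> \<one>) \<otimes> ?b i) = a(n := \<zero>)"
          using ac by (auto simp: l_minus r_neg)
        finally have "(\<Oplus>i\<in>{..<n}. w i \<otimes> (a(n := \<zero>)) i) \<in> I"
          using a(2) by (intro wN[rule_format]) auto
        also have "(\<Oplus>i\<in>{..<n}. w i \<otimes> (a(n := \<zero>)) i) = (\<Oplus>i\<in>{..<n}. ?w i \<otimes> a i)"
          using wc ac by (intro finsum_cong') auto
        also have "\<dots> = (\<Oplus>i\<in>{..<Suc n}. ?w i \<otimes> a i)"
        proof -
          have "(\<Oplus>i\<in>{..<n}. ?w i \<otimes> a i) \<in> carrier R"
            using wc ac by (intro finsum_closed) auto
          then show ?thesis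
            using wc ac unfolding lessThan_Suc
            by (subst finsum_insert) auto
        qed
        finally show ?thesis .
      qed
      then show ?thesis
        using k wc by (intro bexI[of _ ?w] conjI exI[of _ k]) auto
    qed
  next
    case False
    \<comment> \<open>Here \<open>N\<close> contains every vector supported below \<open>n\<close>.
      The vector \<open>?e\<close>, read as a functional, is projection to coordinate
      \<open>n\<close>; read as a vector, it is outside \<open>N\<close>, since otherwise
      \<open>v\<close> would be in \<open>N\<close>.\<close>
    let ?e = "\<lambda>i. if i = n then \<one> else \<zero>"
    have e_N: "?e \<notin> N"
    proof
      assume e: "?e \<in> N"
      have "?supp n (v(n := \<zero>))"
        using Suc.prems(2) by auto
      moreover have "v(n := \<zero>) \<in> UNIV \<rightarrow> carrier R"
        using Suc.prems(1) by auto
      ultimately have "v(n := \<zero>) \<in> N"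
        using False by blast
      then have "(\<lambda>i. \<one> \<otimes> (v(n := \<zero>)) i \<oplus> v n \<otimes> ?e i) \<in> N"
        by (rule lin) (use e Suc.prems(1) in auto)

      also have "(\<lambda>i. \<one> \<otimes> (v(n := \<zero>)) i \<oplus> v n \<otimes> ?e i) = v"
        using Suc.prems(1) by (auto simp: fun_eq_iff Pi_def)
      finally show False
        using Suc.prems by blast
    qed
    \<comment> \<open>Removing the coordinates below \<open>n\<close> leaves \<open>a n\<close>
      times \<open>?e\<close> in \<open>N\<close>. If \<open>a n\<close> were outside
      \<open>I\<close>, saturation would put \<open>?e\<close> into \<open>N\<close>.\<close>
    have "a n \<in> I" if a: "a \<in> N" "?supp (Suc n) a" for a
    proof (rule ccontr)
      assume an: "a n \<notin> I"
      have ac: "a i \<in> carrier R" for i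
        using Nc a(1) by blast
      have "?supp n (a(n := \<zero>))"
        using a(2) by auto
      moreover have "a(n := \<zero>) \<in> UNIV \<rightarrow> carrier R"
        using ac by auto
      ultimately have "a(n := \<zero>) \<in> N"
        using False by blast
      with a(1) have "(\<lambda>i. \<one> \<otimes> a i \<oplus> (\<ominus> \<one>) \<otimes> (a(n := \<zero>)) i) \<in> N"
        by (rule lin) auto
      also have "(\<lambda>i. \<one> \<otimes> a i \<oplus> (\<ominus> \<one>) \<otimes> (a(n := \<zero>)) i) = (\<lambda>i. a n \<otimes> ?e i)"
        using ac by (auto simp: l_minus r_neg)
      finally show False
        using sat[of ?e "a n"] an ac e_N by auto
    qed
    moreover have "(\<Oplus>i\<in>{..<Suc n}. ?e i \<otimes> a i) = a n" if a: "a \<in> N" for a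
    proof -
      have "(\<Oplus>i\<in>{..<n}. ?e i \<otimes> a i) = (\<Oplus>i\<in>{..<n}. \<zero>)"
        using Nc[OF a] by (intro finsum_cong') auto
      then show ?thesis
        using Nc[OF a] unfolding lessThan_Suc
        by (subst finsum_insert) auto
    qed
    ultimately show ?thesis
      using one_not_mem by (intro bexI[of _ ?e] conjI exI[of _ n]) auto
  qed
qed

section \<open>Linear combinations, and Nakayama's lemma at a prime\<close>

context module
begin

abbreviation lincomb :: "(nat \<Rightarrow> 'a) \<Rightarrow> (nat \<Rightarrow> 'c) \<Rightarrow> nat \<Rightarrow> 'c" where
  "lincomb a x n \<equiv> \<Oplus>\<^bsub>M\<^esub>i\<in>{..<n}. a i \<odot>\<^bsub>M\<^esub> x i"

lemma lincomb_closed: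
  assumes "a \<in> {..<n} \<rightarrow> carrier R" "x \<in> {..<n} \<rightarrow> carrier M"
  shows "lincomb a x n \<in> carrier M"
  using assms by (intro M.finsum_closed) auto

lemma lincomb_Suc:
  assumes "a \<in> {..<Suc n} \<rightarrow> carrier R" "x \<in> {..<Suc n} \<rightarrow> carrier M"
  shows "lincomb a x (Suc n) = a n \<odot>\<^bsub>M\<^esub> x n \<oplus>\<^bsub>M\<^esub> lincomb a x n"
  unfolding lessThan_Suc using assms by (intro M.finsum_insert) (auto simp: Pi_def)

lemma lincomb_add:
  assumes "a \<in> {..<n} \<rightarrow> carrier R" "b \<in> {..<n} \<rightarrow> carrier R" "x \<in> {..<n} \<rightarrow> carrier M"
  shows "lincomb (\<lambda>i. a i \<oplus> b i) x n = lincomb a x n \<oplus>\<^bsub>M\<^esub> lincomb b x n"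
proof -
  have "lincomb (\<lambda>i. a i \<oplus> b i) x n = (\<Oplus>\<^bsub>M\<^esub>i\<in>{..<n}. a i \<odot>\<^bsub>M\<^esub> x i \<oplus>\<^bsub>M\<^esub> b i \<odot>\<^bsub>M\<^esub> x i)"
    using assms by (intro M.finsum_cong') (auto simp: smult_l_distr Pi_def)
  also have "\<dots> = lincomb a x n \<oplus>\<^bsub>M\<^esub> lincomb b x n"
    using assms by (intro M.finsum_addf) auto
  finally show ?thesis .
qed

lemma lincomb_smult:
  assumes "r \<in> carrier R" "a \<in> {..<n} \<rightarrow> carrier R" "x \<in> {..<n} \<rightarrow> carrier M"
  shows "lincomb (\<lambda>i. r \<otimes> a i) x n = r \<odot>\<^bsub>M\<^esub> lincomb a x n"
proof -
  have "lincomb (\<lambda>i. r \<otimes> a i) x n = (\<Oplus>\<^bsub>M\<^esub>i\<in>{..<n}. r \<odot>\<^bsub>M\<^esub> (a i \<odot>\<^bsub>M\<^esub> x i))"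
    using assms by (intro M.finsum_cong') (auto simp: smult_assoc1 Pi_def)
  also have "\<dots> = r \<odot>\<^bsub>M\<^esub> lincomb a x n"
    using assms by (subst finsum_smult_ldistr) auto
  finally show ?thesis .
qed

lemma lincomb_cong:
  assumes "\<And>i. i < n \<Longrightarrow> a i = b i" "b \<in> {..<n} \<rightarrow> carrier R" "x \<in> {..<n} \<rightarrow> carrier M"
  shows "lincomb a x n = lincomb b x n"
  using assms by (intro M.finsum_cong') auto

lemma lincomb_delta:
  assumes "k < n" "x \<in> {..<n} \<rightarrow> carrier M"
  shows "lincomb (\<lambda>i. if i = k then \<one> else \<zero>) x n = x k"
proof -
  have "lincomb (\<lambda>i. if i = k then \<one> else \<zero>) x n =
      (\<Oplus>\<^bsub>M\<^esub>i\<in>{..<n}. if k = i then x i else \<zero>\<^bsub>M\<^esub>)"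
    using assms by (intro M.finsum_cong') (auto simp: Pi_def)
  also have "\<dots> = x k"
    using assms by (intro M.finsum_singleton) auto
  finally show ?thesis .
qed

lemma smult_left_commute:
  assumes "a \<in> carrier R" "b \<in> carrier R" "x \<in> carrier M"
  shows "a \<odot>\<^bsub>M\<^esub> (b \<odot>\<^bsub>M\<^esub> x) = b \<odot>\<^bsub>M\<^esub> (a \<odot>\<^bsub>M\<^esub> x)"
  using assms by (simp add: R.m_comm flip: smult_assoc1)

text \<open>Nakayama's lemma for the span of the \<open>x k\<close> localized at \<open>p\<close>,
  with multipliers outside \<open>p\<close> in place of denominators. Generators are eliminated one
  at a time: the last equation is solved for \<open>x n\<close> and substituted into the others,
  which leaves the same hypothesis with one generator fewer.\<close>

lemma primeideal_nakayama:
  assumes "primeideal p R"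
    and "x \<in> {..<n} \<rightarrow> carrier M"
    and "\<And>k. k < n \<Longrightarrow> \<exists>u\<in>carrier R - p. \<exists>b\<in>UNIV \<rightarrow> p. u \<odot>\<^bsub>M\<^esub> x k = lincomb b x n"
  shows "\<exists>v\<in>carrier R - p. \<forall>k<n. v \<odot>\<^bsub>M\<^esub> x k = \<zero>\<^bsub>M\<^esub>"
  using assms(2,3)
proof (induction n)
  case 0
  interpret p: primeideal p R by fact
  show ?case
    using p.one_not_mem by blast
next
  case (Suc n)
  interpret p: primeideal p R by fact
  have pc: "b i \<in> carrier R" if "b \<in> UNIV \<rightarrow> p" for b and i :: nat
    using that p.a_subset by auto
  have xc: "x i \<in> carrier M" if "i \<le> n" for i
    using Suc.prems(1) that by auto
  then have xn: "x \<in> {..<n} \<rightarrow> carrier M"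
    by auto
  obtain u b where u: "u \<in> carrier R - p" and b: "b \<in> UNIV \<rightarrow> p"
    and ub: "u \<odot>\<^bsub>M\<^esub> x n = lincomb b x (Suc n)"
    using Suc.prems(2)[of n] by auto
  have bc: "b i \<in> carrier R" for i
    using pc b by blast
  \<comment> \<open>The coefficient of \<open>x n\<close> once its term on the right has been moved
    to the left. It stays outside \<open>p\<close> because \<open>b n\<close> lies in
    \<open>p\<close> and \<open>u\<close> does not.\<close>
  define u' where "u' = u \<oplus> \<ominus> b n"
  have u'c: "u' \<in> carrier R"
    using u bc by (auto simp: u'_def)
  have u'p: "u' \<notin> p"
  proof
    assume "u' \<in> p"
    then have "u' \<oplus> b n \<in> p"
      using b by (intro p.a_closed) auto
    moreover have "u' \<oplus> b n = u"
      using u bc by (auto simp: u'_def R.a_assoc R.l_neg)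
    ultimately show False
      using u by auto
  qed
  have last: "u' \<odot>\<^bsub>M\<^esub> x n = lincomb b x n"
  proof -
    have "u' \<odot>\<^bsub>M\<^esub> x n = u \<odot>\<^bsub>M\<^esub> x n \<oplus>\<^bsub>M\<^esub> \<ominus>\<^bsub>M\<^esub> (b n \<odot>\<^bsub>M\<^esub> x n)"
      using u bc xc by (simp add: u'_def smult_l_distr smult_l_minus)
    also have "u \<odot>\<^bsub>M\<^esub> x n = b n \<odot>\<^bsub>M\<^esub> x n \<oplus>\<^bsub>M\<^esub> lincomb b x n"
      unfolding ub using bc Suc.prems(1) by (intro lincomb_Suc) auto
    finally show ?thesis
      using bc xc lincomb_closed[of b n x] xn
      by (simp add: M.a_ac M.r_neg1 M.r_neg2 Pi_def)
  qed
  have "\<exists>u\<in>carrier R - p. \<exists>b\<in>UNIV \<rightarrow> p. u \<odot>\<^bsub>M\<^esub> x k = lincomb b x n" if k: "k < n" for k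
  proof -
    obtain t c where t: "t \<in> carrier R - p" and c: "c \<in> UNIV \<rightarrow> p"
      and tc: "t \<odot>\<^bsub>M\<^esub> x k = lincomb c x (Suc n)"
      using Suc.prems(2)[of k] k by auto
    have cc: "c i \<in> carrier R" for i
      using pc c by blast
    \<comment> \<open>Multiplying the equation for \<open>x k\<close> by \<open>u'\<close> allows
      \<open>u'\<close> times \<open>x n\<close> to be replaced through \<open>last\<close>;
      \<open>?d\<close> collects the resulting coefficients.\<close>
    let ?d = "\<lambda>i. c n \<otimes> b i \<oplus> u' \<otimes> c i"
    have "(u' \<otimes> t) \<odot>\<^bsub>M\<^esub> x k = u' \<odot>\<^bsub>M\<^esub> (c n \<odot>\<^bsub>M\<^esub> x n \<oplus>\<^bsub>M\<^esub> lincomb c x n)"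
      using t u'c xc k tc cc Suc.prems(1) by (simp add: smult_assoc1 lincomb_Suc)
    also have "\<dots> = c n \<odot>\<^bsub>M\<^esub> (u' \<odot>\<^bsub>M\<^esub> x n) \<oplus>\<^bsub>M\<^esub> u' \<odot>\<^bsub>M\<^esub> lincomb c x n"
      using u'c xc cc lincomb_closed[of c n x] xn
      by (simp add: smult_r_distr R.m_comm Pi_def flip: smult_assoc1)
    also have "\<dots> = lincomb ?d x n"
      unfolding last using u'c cc bc xn by (simp add: lincomb_add lincomb_smult)
    finally have "(u' \<otimes> t) \<odot>\<^bsub>M\<^esub> x k = lincomb ?d x n" .
    moreover have "u' \<otimes> t \<in> carrier R - p"
      using u'c u'p t p.I_prime by auto
    moreover have "?d \<in> UNIV \<rightarrow> p"
      using b c cc u'c by (auto intro!: p.a_closed p.I_l_closed)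
    ultimately show ?thesis
      by (intro bexI[of _ "u' \<otimes> t"] bexI[of _ ?d])
  qed
  then obtain v where v: "v \<in> carrier R - p" "\<And>k. k < n \<Longrightarrow> v \<odot>\<^bsub>M\<^esub> x k = \<zero>\<^bsub>M\<^esub>"
    using Suc.IH xn by blast
  \<comment> \<open>\<open>v\<close> kills the first \<open>n\<close> generators, and
    \<open>u'\<close> times \<open>x n\<close> is a combination of these, so the product also kills
    \<open>x n\<close>.\<close>
  have "(v \<otimes> u') \<odot>\<^bsub>M\<^esub> x k = \<zero>\<^bsub>M\<^esub>" if "k < Suc n" for k
  proof (cases "k = n")
    case True
    have "(v \<otimes> u') \<odot>\<^bsub>M\<^esub> x k = v \<odot>\<^bsub>M\<^esub> lincomb b x n"
      using True v u'c xc last by (simp add: smult_assoc1)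
    also have "\<dots> = (\<Oplus>\<^bsub>M\<^esub>i\<in>{..<n}. v \<odot>\<^bsub>M\<^esub> (b i \<odot>\<^bsub>M\<^esub> x i))"
      using v bc xn by (intro finsum_smult_ldistr) auto
    also have "\<dots> = (\<Oplus>\<^bsub>M\<^esub>i\<in>{..<n}. \<zero>\<^bsub>M\<^esub>)"
    proof (intro M.finsum_cong')
      fix i assume i: "i \<in> {..<n}"
      have "v \<odot>\<^bsub>M\<^esub> (b i \<odot>\<^bsub>M\<^esub> x i) = b i \<odot>\<^bsub>M\<^esub> (v \<odot>\<^bsub>M\<^esub> x i)"
        using v(1) bc xc i by (intro smult_left_commute) auto
      then show "v \<odot>\<^bsub>M\<^esub> (b i \<odot>\<^bsub>M\<^esub> x i) = \<zero>\<^bsub>M\<^esub>"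
        using v bc i by simp
    qed auto
    finally show ?thesis
      by simp
  next
    case False
    then have "(v \<otimes> u') \<odot>\<^bsub>M\<^esub> x k = u' \<odot>\<^bsub>M\<^esub> (v \<odot>\<^bsub>M\<^esub> x k)"
      using that v(1) u'c xc by (simp add: R.m_comm flip: smult_assoc1)
    then show ?thesis
      using False that v u'c by simp
  qed
  moreover have "v \<otimes> u' \<in> carrier R - p"
    using u'c u'p v p.I_prime by auto
  ultimately show ?case
    by blast
qed

text \<open>In coordinates, \<open>w\<close> is a nonzero map from the span of the
  \<open>x k\<close> to R/p; sending relations into \<open>p\<close> makes it well defined. By
  \<open>nz\<close> the localized span is nonzero, so by Nakayama its multiples by \<open>p\<close>
  form a proper submodule, whose preimage in the coordinate vectors is fed to
  \<open>separating_functional\<close>.\<close>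

lemma exists_functional_mod_prime:
  assumes "primeideal p R"
    and x: "x \<in> {..<n} \<rightarrow> carrier M"
    and nz: "\<And>v. v \<in> carrier R - p \<Longrightarrow> \<exists>k<n. v \<odot>\<^bsub>M\<^esub> x k \<noteq> \<zero>\<^bsub>M\<^esub>"
  shows "\<exists>w\<in>UNIV \<rightarrow> carrier R. (\<exists>k<n. w k \<notin> p) \<and>
    (\<forall>a\<in>{..<n} \<rightarrow> carrier R. lincomb a x n = \<zero>\<^bsub>M\<^esub> \<longrightarrow> (\<Oplus>i\<in>{..<n}. w i \<otimes> a i) \<in> p)"
proof -
  interpret p: primeideal p R by fact
  note one_p = p.one_not_mem
  have pc: "b i \<in> carrier R" if "b \<in> UNIV \<rightarrow> p" for b and i :: nat
    using that p.a_subset by auto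
  \<comment> \<open>The coefficient vectors whose combination lands in \<open>p\<close> times the
    span after localizing at \<open>p\<close>; the multiplier \<open>u\<close> makes this set
    saturated.\<close>
  define N where "N = {a \<in> UNIV \<rightarrow> carrier R.
    \<exists>u\<in>carrier R - p. \<exists>b\<in>UNIV \<rightarrow> p. u \<odot>\<^bsub>M\<^esub> lincomb a x n = lincomb b x n}"
  \<comment> \<open>Nakayama read backwards: not every \<open>x k\<close> satisfies its hypothesis,
    so some unit vector lies outside \<open>N\<close>.\<close>
  have "\<exists>k<n. \<not> (\<exists>u\<in>carrier R - p. \<exists>b\<in>UNIV \<rightarrow> p. u \<odot>\<^bsub>M\<^esub> x k = lincomb b x n)"
  proof (rule ccontr)
    assume "\<not> ?thesis"
    then have "\<exists>v\<in>carrier R - p. \<forall>k<n. v \<odot>\<^bsub>M\<^esub> x k = \<zero>\<^bsub>M\<^esub>"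
      by (intro primeideal_nakayama[OF assms(1) x]) blast
    then show False
      using nz by blast
  qed
  then obtain k where k: "k < n"
    "\<not> (\<exists>u\<in>carrier R - p. \<exists>b\<in>UNIV \<rightarrow> p. u \<odot>\<^bsub>M\<^esub> x k = lincomb b x n)"
    by blast
  let ?e = "\<lambda>i. if i = k then \<one> else \<zero>"
  have "\<exists>w \<in> UNIV \<rightarrow> carrier R. (\<exists>k<n. w k \<notin> p) \<and>
    (\<forall>a\<in>N. (\<forall>i\<ge>n. a i = \<zero>) \<longrightarrow> (\<Oplus>i\<in>{..<n}. w i \<otimes> a i) \<in> p)"
  proof (rule p.separating_functional)
    show "N \<subseteq> UNIV \<rightarrow> carrier R"
      by (auto simp: N_def)
    show "UNIV \<rightarrow> p \<subseteq> N"
    proof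
      fix b :: "nat \<Rightarrow> 'a" assume b: "b \<in> UNIV \<rightarrow> p"
      then have "\<one> \<odot>\<^bsub>M\<^esub> lincomb b x n = lincomb b x n"
        using x pc by (intro smult_one lincomb_closed) auto
      then show "b \<in> N"
        using b one_p pc by (auto simp: N_def)
    qed
    show "?e \<in> UNIV \<rightarrow> carrier R" "\<forall>i\<ge>n. ?e i = \<zero>"
      using k by auto
    show "?e \<notin> N"
      using k x by (auto simp: N_def lincomb_delta)
  next
    fix a b r s assume a: "a \<in> N" and b: "b \<in> N" and r: "r \<in> carrier R" and s: "s \<in> carrier R"
    obtain u c where u: "u \<in> carrier R - p" and c: "c \<in> UNIV \<rightarrow> p"
      and uc: "u \<odot>\<^bsub>M\<^esub> lincomb a x n = lincomb c x n" and ac: "a \<in> UNIV \<rightarrow> carrier R"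
      using a by (auto simp: N_def)
    obtain t d where t: "t \<in> carrier R - p" and d: "d \<in> UNIV \<rightarrow> p"
      and td: "t \<odot>\<^bsub>M\<^esub> lincomb b x n = lincomb d x n" and bc: "b \<in> UNIV \<rightarrow> carrier R"
      using b by (auto simp: N_def)
    \<comment> \<open>\<open>u\<close> and \<open>t\<close> act as denominators. Over the common
      denominator \<open>u \<otimes> t\<close>, each numerator is multiplied by the other
      denominator.\<close>
    let ?f = "\<lambda>i. (t \<otimes> r) \<otimes> c i \<oplus> (u \<otimes> s) \<otimes> d i"
    have la: "lincomb a x n \<in> carrier M" and lb: "lincomb b x n \<in> carrier M"
      using ac bc x by (auto intro!: lincomb_closed)
    have "lincomb ?f x n = (t \<otimes> r) \<odot>\<^bsub>M\<^esub> lincomb c x n \<oplus>\<^bsub>M\<^esub> (u \<otimes> s) \<odot>\<^bsub>M\<^esub> lincomb d x n"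
      using pc c d r s u t x by (subst lincomb_add) (auto simp: lincomb_smult)
    also have "\<dots> = (u \<otimes> t) \<odot>\<^bsub>M\<^esub> (r \<odot>\<^bsub>M\<^esub> lincomb a x n \<oplus>\<^bsub>M\<^esub> s \<odot>\<^bsub>M\<^esub> lincomb b x n)"
      using u t r s la lb
      by (simp add: smult_r_distr R.m_ac flip: uc td smult_assoc1)
    also have "r \<odot>\<^bsub>M\<^esub> lincomb a x n \<oplus>\<^bsub>M\<^esub> s \<odot>\<^bsub>M\<^esub> lincomb b x n =
        lincomb (\<lambda>i. r \<otimes> a i \<oplus> s \<otimes> b i) x n"
      using ac bc r s x by (subst lincomb_add) (auto simp: lincomb_smult Pi_def)
    finally have "(u \<otimes> t) \<odot>\<^bsub>M\<^esub> lincomb (\<lambda>i. r \<otimes> a i \<oplus> s \<otimes> b i) x n = lincomb ?f x n"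
      by simp
    moreover have "u \<otimes> t \<in> carrier R - p"
      using u t p.I_prime by auto
    moreover have "?f \<in> UNIV \<rightarrow> p"
      using c d r s u t by (auto intro!: p.a_closed p.I_l_closed)
    moreover have "(\<lambda>i. r \<otimes> a i \<oplus> s \<otimes> b i) \<in> UNIV \<rightarrow> carrier R"
      using ac bc r s by auto
    ultimately show "(\<lambda>i. r \<otimes> a i \<oplus> s \<otimes> b i) \<in> N"
      unfolding N_def by (intro CollectI conjI bexI[of _ "u \<otimes> t"] bexI[of _ ?f])
  next
    fix a u assume a: "a \<in> UNIV \<rightarrow> carrier R" and u: "u \<in> carrier R - p"
      and ua: "(\<lambda>i. u \<otimes> a i) \<in> N"
    obtain t d where t: "t \<in> carrier R - p" and d: "d \<in> UNIV \<rightarrow> p"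
      and td: "t \<odot>\<^bsub>M\<^esub> lincomb (\<lambda>i. u \<otimes> a i) x n = lincomb d x n"
      using ua by (auto simp: N_def)
    have "lincomb a x n \<in> carrier M"
      using a x by (auto intro!: lincomb_closed)
    then have "(t \<otimes> u) \<odot>\<^bsub>M\<^esub> lincomb a x n = t \<odot>\<^bsub>M\<^esub> (u \<odot>\<^bsub>M\<^esub> lincomb a x n)"
      using t u by (intro smult_assoc1) auto
    also have "\<dots> = lincomb d x n"
      using td a u x by (subst (asm) lincomb_smult) auto
    finally have "(t \<otimes> u) \<odot>\<^bsub>M\<^esub> lincomb a x n = lincomb d x n" .
    moreover have "t \<otimes> u \<in> carrier R - p"
      using u t p.I_prime by auto
    ultimately show "a \<in> N"
      using a d unfolding N_def by blast
  qed
  then obtain w j where w: "w \<in> UNIV \<rightarrow> carrier R" "j < n" "w j \<notin> p"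
    and wN: "\<And>a. \<lbrakk>a \<in> N; \<forall>i\<ge>n. a i = \<zero>\<rbrakk> \<Longrightarrow> (\<Oplus>i\<in>{..<n}. w i \<otimes> a i) \<in> p"
    by blast
  have "(\<Oplus>i\<in>{..<n}. w i \<otimes> a i) \<in> p"
    if a: "a \<in> {..<n} \<rightarrow> carrier R" "lincomb a x n = \<zero>\<^bsub>M\<^esub>" for a
  proof -
    \<comment> \<open>\<open>a\<close> is controlled only below \<open>n\<close>, while
      \<open>N\<close> consists of total functions, so it is extended by zero. A relation lies in
      \<open>N\<close> with multiplier one and zero numerator \<open>?z\<close>.\<close>
    let ?a = "\<lambda>i. if i < n then a i else \<zero>"
    let ?z = "\<lambda>i. \<zero>"
    have "lincomb ?a x n = \<zero>\<^bsub>M\<^esub>"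
      using a x by (subst lincomb_cong[of n ?a a]) auto
    moreover have "lincomb ?z x n = \<zero>\<^bsub>M\<^esub>"
      using x by (intro M.add.finprod_one_eqI) (auto simp: Pi_def)
    ultimately have "?a \<in> N"
      using a one_p unfolding N_def by (auto intro!: bexI[of _ \<one>] bexI[of _ ?z])
    then have "(\<Oplus>i\<in>{..<n}. w i \<otimes> ?a i) \<in> p"
      by (intro wN) auto
    also have "(\<Oplus>i\<in>{..<n}. w i \<otimes> ?a i) = (\<Oplus>i\<in>{..<n}. w i \<otimes> a i)"
      using w a by (intro R.finsum_cong') auto
    finally show ?thesis .
  qed
  then show ?thesis
    using w by blast
qed

end

section \<open>Presentations and supports\<close>

lemma module_homD:
  assumes "f \<in> module_hom R M N"
  shows "f \<in> carrier M \<rightarrow>\<^sub>E carrier N"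
    and "\<lbrakk>x \<in> carrier M; y \<in> carrier M\<rbrakk> \<Longrightarrow> f (x \<oplus>\<^bsub>M\<^esub> y) = f x \<oplus>\<^bsub>N\<^esub> f y"
    and "\<lbrakk>r \<in> carrier R; x \<in> carrier M\<rbrakk> \<Longrightarrow> f (r \<odot>\<^bsub>M\<^esub> x) = r \<odot>\<^bsub>N\<^esub> f x"
  using assms by (auto simp: module_hom_def)

lemma carrier_free_module [simp]: "carrier (free_module R n) = {..<n} \<rightarrow>\<^sub>E carrier R"
  by (simp add: free_module_def)

lemma (in cring) module_free_module: "module R (free_module R n)"
proof (rule moduleI)
  show "abelian_group (free_module R n)"
  proof (rule abelian_groupI)
    fix v assume v: "v \<in> carrier (free_module R n)"
    then show "\<exists>w\<in>carrier (free_module R n). w \<oplus>\<^bsub>free_module R n\<^esub> v = \<zero>\<^bsub>free_module R n\<^esub>"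
      by (intro bexI[of _ "\<lambda>i\<in>{..<n}. \<ominus> v i"])
        (auto simp: free_module_def l_neg PiE_iff intro!: restrict_ext)
  qed (auto simp: free_module_def PiE_iff a_ac extensional_def fun_eq_iff)
qed (auto simp: free_module_def PiE_iff l_distr r_distr m_assoc extensional_def fun_eq_iff is_cring)

section \<open>Coordinates from a presentation, and supports in terms of annihilation\<close>

context module
begin

lemma lincomb_free_add:
  assumes "a \<in> carrier (free_module R n)" "b \<in> carrier (free_module R n)"
    "x \<in> {..<n} \<rightarrow> carrier M"
  shows "lincomb (a \<oplus>\<^bsub>free_module R n\<^esub> b) x n = lincomb a x n \<oplus>\<^bsub>M\<^esub> lincomb b x n"
proof -
  have "lincomb (a \<oplus>\<^bsub>free_module R n\<^esub> b) x n = lincomb (\<lambda>i. a i \<oplus> b i) x n"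
    using assms by (intro lincomb_cong) (auto simp: free_module_def)
  then show ?thesis
    using assms by (subst lincomb_add[symmetric]) auto
qed

lemma lincomb_free_smult:
  assumes "r \<in> carrier R" "a \<in> carrier (free_module R n)" "x \<in> {..<n} \<rightarrow> carrier M"
  shows "lincomb (r \<odot>\<^bsub>free_module R n\<^esub> a) x n = r \<odot>\<^bsub>M\<^esub> lincomb a x n"
proof -
  have "lincomb (r \<odot>\<^bsub>free_module R n\<^esub> a) x n = lincomb (\<lambda>i. r \<otimes> a i) x n"
    using assms by (intro lincomb_cong) (auto simp: free_module_def)
  then show ?thesis
    using assms by (subst lincomb_smult[symmetric]) auto
qed

lemma module_hom_free_module_eq_lincomb:
  assumes F: "F \<in> module_hom R (free_module R n) M" and v: "v \<in> carrier (free_module R n)"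
  shows "F v = lincomb v (\<lambda>k. F (\<lambda>i\<in>{..<n}. if i = k then \<one> else \<zero>)) n"
proof -
  let ?V = "free_module R n"
  let ?e = "\<lambda>k. \<lambda>i\<in>{..<n}. if i = k then \<one> else \<zero>"
  \<comment> \<open>Truncations of \<open>v\<close> to the first \<open>m\<close> coordinates; each
    step of the induction adds one multiple of a unit vector.\<close>
  let ?t = "\<lambda>m. \<lambda>i\<in>{..<n}. if i < m then v i else \<zero>"
  interpret V: module R ?V
    by (rule module_free_module)
  have vc: "v i \<in> carrier R" if "i < n" for i
    using v that by auto
  have tc: "?t m \<in> carrier ?V" for m
    using vc by auto
  have ec: "?e k \<in> carrier ?V" for k
    by auto
  have Fc: "F u \<in> carrier M" if "u \<in> carrier ?V" for u
    using module_homD(1)[OF F] that by auto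
  have "F (?t m) = lincomb v (\<lambda>k. F (?e k)) m" if "m \<le> n" for m
    using that
  proof (induction m)
    case 0
    \<comment> \<open>Preservation of zero is not a clause of \<open>module_hom\<close>; writing
      zero as a scalar multiple by zero lets homogeneity supply it.\<close>
    have "?t 0 = \<zero> \<odot>\<^bsub>?V\<^esub> \<zero>\<^bsub>?V\<^esub>"
      by (auto simp: free_module_def)
    then have "F (?t 0) = F (\<zero> \<odot>\<^bsub>?V\<^esub> \<zero>\<^bsub>?V\<^esub>)"
      by (rule arg_cong)
    also have "\<dots> = \<zero> \<odot>\<^bsub>M\<^esub> F \<zero>\<^bsub>?V\<^esub>"
      using V.zero_closed by (intro module_homD(3)[OF F]) auto
    also have "\<dots> = \<zero>\<^bsub>M\<^esub>"
      using Fc V.zero_closed by (intro smult_l_null) auto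
    finally show ?case
      by (simp only: lessThan_0 M.finsum_empty)
  next
    case (Suc m)
    have "?t (Suc m) = v m \<odot>\<^bsub>?V\<^esub> ?e m \<oplus>\<^bsub>?V\<^esub> ?t m"
      using vc Suc.prems by (auto simp: free_module_def fun_eq_iff less_Suc_eq)
    then have "F (?t (Suc m)) = v m \<odot>\<^bsub>M\<^esub> F (?e m) \<oplus>\<^bsub>M\<^esub> F (?t m)"
      using module_homD(2,3)[OF F] vc Suc.prems ec tc V.smult_closed by simp
    also have "F (?t m) = lincomb v (\<lambda>k. F (?e k)) m"
      by (rule Suc.IH) (use Suc.prems in simp)
    also have "v m \<odot>\<^bsub>M\<^esub> F (?e m) \<oplus>\<^bsub>M\<^esub> \<dots> = lincomb v (\<lambda>k. F (?e k)) (Suc m)"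
      using vc Suc.prems Fc[OF ec] by (subst lincomb_Suc) auto
    finally show ?case .
  qed
  moreover have "?t n = v"
    using v by (auto simp: PiE_iff extensional_def fun_eq_iff)
  ultimately show ?thesis
    by (metis (no_types, lifting) order_refl)
qed

text \<open>The images of the unit vectors under the presenting surjection serve as generators,
  which turns its kernel into the module of relations among them.\<close>

lemma fin_presented_generators:
  assumes "fin_presented R M"
  obtains n x X where "x \<in> {..<n} \<rightarrow> carrier M"
    and "(\<lambda>a. lincomb a x n) ` carrier (free_module R n) = carrier M"
    and "finite X" "X \<subseteq> carrier (free_module R n)"
    and "{a \<in> carrier (free_module R n). lincomb a x n = \<zero>\<^bsub>M\<^esub>} = gen_submodule R (free_module R n) X"
proof -
  obtain n F X where F: "F \<in> module_hom R (free_module R n) M"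
    and surj: "F ` carrier (free_module R n) = carrier M"
    and X: "finite X" "X \<subseteq> carrier (free_module R n)"
      "{v \<in> carrier (free_module R n). F v = \<zero>\<^bsub>M\<^esub>} = gen_submodule R (free_module R n) X"
    using assms unfolding fin_presented_def fin_gen_submodule_def by blast
  define x where "x = (\<lambda>k. F (\<lambda>i\<in>{..<n}. if i = k then \<one> else \<zero>))"
  have F_eq: "F v = lincomb v x n" if "v \<in> carrier (free_module R n)" for v
    unfolding x_def using module_hom_free_module_eq_lincomb[OF F that] .
  show thesis
  proof
    show "x \<in> {..<n} \<rightarrow> carrier M"
      unfolding x_def by (intro funcsetI PiE_mem[OF module_homD(1)[OF F]]) auto
    show "(\<lambda>a. lincomb a x n) ` carrier (free_module R n) = carrier M"
      unfolding surj[symmetric] by (intro image_cong) (simp_all only: F_eq)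
    show "{a \<in> carrier (free_module R n). lincomb a x n = \<zero>\<^bsub>M\<^esub>} = gen_submodule R (free_module R n) X"
      unfolding X(3)[symmetric] by (intro Collect_cong conj_cong) (simp_all only: F_eq)
  qed (use X in auto)
qed

text \<open>If \<open>v\<close> killed the whole module, it would witness the equality of any two
  fractions, and the localization would have a single element.\<close>

lemma Supp_not_annihilated:
  assumes p: "p \<in> Supp R M" and v: "v \<in> carrier R - p"
  shows "\<exists>y\<in>carrier M. v \<odot>\<^bsub>M\<^esub> y \<noteq> \<zero>\<^bsub>M\<^esub>"
proof (rule ccontr)
  assume "\<not> ?thesis"
  then have v0: "v \<odot>\<^bsub>M\<^esub> y = \<zero>\<^bsub>M\<^esub>" if "y \<in> carrier M" for y
    using that by blast
  interpret p: primeideal p R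
    using p by (simp add: Supp_def Spec_def)
  note one_p = p.one_not_mem
  let ?T = "carrier R - p"
  have rel: "frac_rel R M ?T = (carrier M \<times> ?T) \<times> (carrier M \<times> ?T)"
  proof -
    have "\<exists>u\<in>?T. u \<odot>\<^bsub>M\<^esub> (t \<odot>\<^bsub>M\<^esub> x) = u \<odot>\<^bsub>M\<^esub> (s \<odot>\<^bsub>M\<^esub> y)"
      if "x \<in> carrier M" "y \<in> carrier M" "s \<in> ?T" "t \<in> ?T" for x y s t
      using that v v0 by (intro bexI[of _ v]) auto
    then show ?thesis
      unfolding frac_rel_def by auto
  qed
  have "carrier (localization R M p) = {\<zero>\<^bsub>localization R M p\<^esub>}"
    unfolding localization_def Let_def frac_def quotient_def rel
    using one_p M.zero_closed by auto
  then show False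
    using p by (simp add: Supp_def)
qed

text \<open>Outside the support, \<open>x/1\<close> and \<open>0/1\<close> are the same class, and
  \<open>u\<close> is the witness of this equality in \<open>frac_rel\<close>.\<close>

lemma not_Supp_annihilated:
  assumes p: "p \<in> Spec R" "p \<notin> Supp R M" and x: "x \<in> carrier M"
  shows "\<exists>u\<in>carrier R - p. u \<odot>\<^bsub>M\<^esub> x = \<zero>\<^bsub>M\<^esub>"
proof -
  interpret p: primeideal p R
    using p by (simp add: Spec_def)
  note one_p = p.one_not_mem
  let ?T = "carrier R - p"
  have "frac R M ?T x \<one> \<in> carrier (localization R M p)"
    using x one_p unfolding localization_def Let_def frac_def by (auto intro: quotientI)
  then have "frac R M ?T x \<one> = frac R M ?T \<zero>\<^bsub>M\<^esub> \<one>"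
    using p by (simp add: Supp_def localization_def Let_def)
  moreover have "(\<zero>\<^bsub>M\<^esub>, \<one>) \<in> frac R M ?T \<zero>\<^bsub>M\<^esub> \<one>"
    using one_p by (auto simp: frac_def frac_rel_def)
  ultimately have "(\<zero>\<^bsub>M\<^esub>, \<one>) \<in> frac R M ?T x \<one>"
    by simp
  then obtain u where "u \<in> ?T" "u \<odot>\<^bsub>M\<^esub> (\<one> \<odot>\<^bsub>M\<^esub> x) = u \<odot>\<^bsub>M\<^esub> (\<one> \<odot>\<^bsub>M\<^esub> \<zero>\<^bsub>M\<^esub>)"
    by (auto simp: frac_def frac_rel_def)
  then show ?thesis
    using x by auto
qed

end

section \<open>Contraction of primes\<close>

lemma Spec_map_Spec:
  assumes "cring R" "cring S" and \<phi>: "\<phi> \<in> ring_hom R S" and P: "P \<in> Spec S"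
  shows "Spec_map R \<phi> P \<in> Spec R"
proof -
  interpret R: cring R by fact
  interpret S: cring S by fact
  interpret h: ring_hom_cring R S \<phi>
    by unfold_locales fact
  interpret P: primeideal P S
    using P by (simp add: Spec_def)
  have "primeideal (Spec_map R \<phi> P) R"
  proof (rule primeidealI)
    show "ideal (Spec_map R \<phi> P) R"
      by (rule idealI[OF R.ring_axioms], unfold_locales)
        (auto simp: Spec_map_def P.I_l_closed P.I_r_closed simp flip: a_inv_def)
    show "carrier R \<noteq> Spec_map R \<phi> P"
      using P.one_not_mem by (auto simp: Spec_map_def dest!: equalityD1)
  qed (use P.I_prime in \<open>auto simp: Spec_map_def R.is_cring\<close>)
  then show ?thesis
    by (simp add: Spec_def)
qed

section \<open>Strong Krull primes of the Hom module\<close>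

lemma Hom_module_simps [simp]:
  "carrier (Hom_module R \<phi> L M) = module_hom R L (restrict_scalars \<phi> M)"
  "\<zero>\<^bsub>Hom_module R \<phi> L M\<^esub> = (\<lambda>x\<in>carrier L. \<zero>\<^bsub>M\<^esub>)"
  "s \<odot>\<^bsub>Hom_module R \<phi> L M\<^esub> f = (\<lambda>x\<in>carrier L. s \<odot>\<^bsub>M\<^esub> f x)"
  by (simp_all add: Hom_module_def)

lemma ann_Hom_module:
  "ann S (Hom_module R \<phi> L M) f = {s \<in> carrier S. \<forall>y\<in>carrier L. s \<odot>\<^bsub>M\<^esub> f y = \<zero>\<^bsub>M\<^esub>}"
  by (auto simp: ann_def fun_eq_iff restrict_def)

text \<open>If each \<open>f (x k)\<close> were killed by some element outside \<open>P\<close>, the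
  product of these finitely many elements would still be outside \<open>P\<close> and would kill
  \<open>f\<close> on the generators, hence on all of \<open>L\<close>, contradicting
  \<open>ann_f\<close>.\<close>

lemma ann_Hom_module_subset_prime:
  assumes \<phi>: "\<phi> \<in> ring_hom R S" and "module R L" and "module S M"
    and P: "primeideal P S"
    and x: "x \<in> {..<n} \<rightarrow> carrier L"
    and gen: "(\<lambda>a. module.lincomb L a x n) ` carrier (free_module R n) = carrier L"
    and f: "f \<in> carrier (Hom_module R \<phi> L M)"
    and ann_f: "ann S (Hom_module R \<phi> L M) f \<subseteq> P"
  shows "\<exists>k<n. ann S M (f (x k)) \<subseteq> P"
proof (rule ccontr)
  assume *: "\<not> ?thesis"
  interpret L: module R L by fact
  interpret M: module S M by fact
  interpret P: primeideal P S by fact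
  interpret h: ring_hom_cring R S \<phi>
    by unfold_locales fact
  have fc: "f y \<in> carrier M" if "y \<in> carrier L" for y
    using module_homD(1)[OF f[simplified]] that by (auto simp: restrict_scalars_def)
  have f_add: "f (y \<oplus>\<^bsub>L\<^esub> z) = f y \<oplus>\<^bsub>M\<^esub> f z" if "y \<in> carrier L" "z \<in> carrier L" for y z
    using module_homD(2)[OF f[simplified] that] by (simp add: restrict_scalars_def)
  have f_smult: "f (r \<odot>\<^bsub>L\<^esub> y) = \<phi> r \<odot>\<^bsub>M\<^esub> f y" if "r \<in> carrier R" "y \<in> carrier L" for r y
    using module_homD(3)[OF f[simplified] that] by (simp add: restrict_scalars_def)
  have xc: "x k \<in> carrier L" if "k < n" for k
    using x that by auto
  have "\<exists>s\<in>carrier S - P. \<forall>k<m. s \<odot>\<^bsub>M\<^esub> f (x k) = \<zero>\<^bsub>M\<^esub>" if "m \<le> n" for m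
    using that
  proof (induction m)
    case 0
    then show ?case
      using P.one_not_mem by (intro bexI[of _ "\<one>\<^bsub>S\<^esub>"]) auto
  next
    case (Suc m)
    then obtain s where s: "s \<in> carrier S - P" "\<And>k. k < m \<Longrightarrow> s \<odot>\<^bsub>M\<^esub> f (x k) = \<zero>\<^bsub>M\<^esub>"
      by auto
    have "\<not> ann S M (f (x m)) \<subseteq> P"
      using * Suc.prems by (simp add: Suc_le_eq)
    then obtain t where t: "t \<in> carrier S - P" "t \<odot>\<^bsub>M\<^esub> f (x m) = \<zero>\<^bsub>M\<^esub>"
      by (auto simp: ann_def)
    have "(s \<otimes>\<^bsub>S\<^esub> t) \<odot>\<^bsub>M\<^esub> f (x k) = \<zero>\<^bsub>M\<^esub>" if k: "k < Suc m" for k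
    proof (cases "k = m")
      case True
      then show ?thesis
        using s(1) t fc xc Suc.prems by (simp add: M.smult_assoc1)
    next
      case False
      have "(s \<otimes>\<^bsub>S\<^esub> t) \<odot>\<^bsub>M\<^esub> f (x k) = t \<odot>\<^bsub>M\<^esub> (s \<odot>\<^bsub>M\<^esub> f (x k))"
        using s(1) t(1) fc xc Suc.prems k
        by (subst M.smult_left_commute) (auto simp: M.smult_assoc1)
      then show ?thesis
        using s(2) t(1) k False by simp
    qed
    moreover have "s \<otimes>\<^bsub>S\<^esub> t \<in> carrier S - P"
      using s(1) t(1) P.I_prime by auto
    ultimately show ?case
      by blast
  qed
  then obtain s where s: "s \<in> carrier S - P" "\<And>k. k < n \<Longrightarrow> s \<odot>\<^bsub>M\<^esub> f (x k) = \<zero>\<^bsub>M\<^esub>"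
    by blast
  have "s \<odot>\<^bsub>M\<^esub> f (L.lincomb a x m) = \<zero>\<^bsub>M\<^esub>"
    if "a \<in> carrier (free_module R n)" "m \<le> n" for a m
    using that(2)
  proof (induction m)
    case 0
    have "f (\<zero>\<^bsub>R\<^esub> \<odot>\<^bsub>L\<^esub> \<zero>\<^bsub>L\<^esub>) = \<phi> \<zero>\<^bsub>R\<^esub> \<odot>\<^bsub>M\<^esub> f \<zero>\<^bsub>L\<^esub>"
      by (intro f_smult) auto
    then show ?case
      using s(1) fc by simp
  next
    case (Suc m)
    have ac: "a i \<in> carrier R" if "i < n" for i
      using \<open>a \<in> _\<close> that by auto
    have lc: "L.lincomb a x m \<in> carrier L"
      using ac xc Suc.prems by (intro L.lincomb_closed) auto
    have "L.lincomb a x (Suc m) = a m \<odot>\<^bsub>L\<^esub> x m \<oplus>\<^bsub>L\<^esub> L.lincomb a x m"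
      using ac xc Suc.prems by (intro L.lincomb_Suc) auto
    then have "s \<odot>\<^bsub>M\<^esub> f (L.lincomb a x (Suc m)) =
        s \<odot>\<^bsub>M\<^esub> (\<phi> (a m) \<odot>\<^bsub>M\<^esub> f (x m)) \<oplus>\<^bsub>M\<^esub> s \<odot>\<^bsub>M\<^esub> f (L.lincomb a x m)"
      using ac xc Suc.prems lc s(1) fc by (simp add: f_add f_smult M.smult_r_distr)
    also have "s \<odot>\<^bsub>M\<^esub> (\<phi> (a m) \<odot>\<^bsub>M\<^esub> f (x m)) = \<phi> (a m) \<odot>\<^bsub>M\<^esub> (s \<odot>\<^bsub>M\<^esub> f (x m))"
      using ac xc Suc.prems s(1) fc by (intro M.smult_left_commute) auto
    finally show ?case
      using Suc ac s by simp
  qed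
  then have "s \<odot>\<^bsub>M\<^esub> f y = \<zero>\<^bsub>M\<^esub>" if "y \<in> carrier L" for y
    using that unfolding gen[symmetric] by blast
  then show False
    using s(1) ann_f unfolding ann_Hom_module by blast
qed

text \<open>The map sends each \<open>x i\<close> to \<open>\<phi> (w i)\<close> times
  \<open>z\<close>; by \<open>Xz\<close> it respects the generating relations. All its values are
  multiples of \<open>z\<close>, which bounds its annihilator from below. Its value at
  \<open>x k\<close>, where \<open>\<phi> (w k)\<close> is outside the prime \<open>P\<close>,
  bounds it from above.\<close>

lemma exists_hom_with_ann:
  assumes \<phi>: "\<phi> \<in> ring_hom R S" and "module R L" and "module S M"
    and P: "primeideal P S"
    and x: "x \<in> {..<n} \<rightarrow> carrier L"
    and gen: "(\<lambda>a. module.lincomb L a x n) ` carrier (free_module R n) = carrier L"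
    and X: "X \<subseteq> carrier (free_module R n)"
    and ker: "{a \<in> carrier (free_module R n). module.lincomb L a x n = \<zero>\<^bsub>L\<^esub>} = gen_submodule R (free_module R n) X"
    and w: "w \<in> UNIV \<rightarrow> carrier R" and k: "k < n" "\<phi> (w k) \<notin> P"
    and z: "z \<in> carrier M" "ann S M z \<subseteq> P"
    and Xz: "\<And>a. a \<in> X \<Longrightarrow> \<phi> (\<Oplus>\<^bsub>R\<^esub>i\<in>{..<n}. w i \<otimes>\<^bsub>R\<^esub> a i) \<in> ann S M z"
  shows "\<exists>f\<in>carrier (Hom_module R \<phi> L M).
    ann S M z \<subseteq> ann S (Hom_module R \<phi> L M) f \<and> ann S (Hom_module R \<phi> L M) f \<subseteq> P"
proof -
  interpret L: module R L by fact
  interpret M: module S M by fact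
  interpret P: primeideal P S by fact
  interpret h: ring_hom_cring R S \<phi>
    by unfold_locales fact
  let ?V = "free_module R n"
  interpret V: module R ?V
    by (rule L.R.module_free_module)
  \<comment> \<open>The map on coordinate vectors that is to descend to \<open>L\<close> along
    \<open>L.lincomb\<close>.\<close>
  define g where "g a = \<phi> (\<Oplus>\<^bsub>R\<^esub>i\<in>{..<n}. w i \<otimes>\<^bsub>R\<^esub> a i) \<odot>\<^bsub>M\<^esub> z" for a
  have wc: "w i \<in> carrier R" for i
    using w by auto
  have dot_closed: "(\<Oplus>\<^bsub>R\<^esub>i\<in>{..<n}. w i \<otimes>\<^bsub>R\<^esub> a i) \<in> carrier R" if "a \<in> carrier ?V" for a
    using that wc by (intro L.R.finsum_closed) auto
  have g_closed: "g a \<in> carrier M" if "a \<in> carrier ?V" for a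
    using dot_closed[OF that] z by (simp add: g_def)
  have g_add: "g (a \<oplus>\<^bsub>?V\<^esub> b) = g a \<oplus>\<^bsub>M\<^esub> g b" if a: "a \<in> carrier ?V" and b: "b \<in> carrier ?V" for a b
  proof -
    have "(\<Oplus>\<^bsub>R\<^esub>i\<in>{..<n}. w i \<otimes>\<^bsub>R\<^esub> (a \<oplus>\<^bsub>?V\<^esub> b) i) =
        (\<Oplus>\<^bsub>R\<^esub>i\<in>{..<n}. w i \<otimes>\<^bsub>R\<^esub> a i \<oplus>\<^bsub>R\<^esub> w i \<otimes>\<^bsub>R\<^esub> b i)"
      using a b wc by (intro L.R.finsum_cong') (auto simp: free_module_def L.R.r_distr PiE_iff)
    also have "\<dots> = (\<Oplus>\<^bsub>R\<^esub>i\<in>{..<n}. w i \<otimes>\<^bsub>R\<^esub> a i) \<oplus>\<^bsub>R\<^esub> (\<Oplus>\<^bsub>R\<^esub>i\<in>{..<n}. w i \<otimes>\<^bsub>R\<^esub> b i)"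
      using a b wc by (intro L.R.finsum_addf) auto
    finally show ?thesis
      using dot_closed[OF a] dot_closed[OF b] z
      by (simp add: g_def M.smult_l_distr del: h.hom_finsum)
  qed
  have g_smult: "g (r \<odot>\<^bsub>?V\<^esub> a) = \<phi> r \<odot>\<^bsub>M\<^esub> g a" if r: "r \<in> carrier R" and a: "a \<in> carrier ?V" for r a
  proof -
    have "(\<Oplus>\<^bsub>R\<^esub>i\<in>{..<n}. w i \<otimes>\<^bsub>R\<^esub> (r \<odot>\<^bsub>?V\<^esub> a) i) = (\<Oplus>\<^bsub>R\<^esub>i\<in>{..<n}. r \<otimes>\<^bsub>R\<^esub> (w i \<otimes>\<^bsub>R\<^esub> a i))"
      using a r wc by (intro L.R.finsum_cong') (auto simp: free_module_def L.R.m_lcomm PiE_iff)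
    also have "\<dots> = r \<otimes>\<^bsub>R\<^esub> (\<Oplus>\<^bsub>R\<^esub>i\<in>{..<n}. w i \<otimes>\<^bsub>R\<^esub> a i)"
      using a r wc by (intro L.R.finsum_rdistr[symmetric]) auto
    finally show ?thesis
      using dot_closed[OF a] r z
      by (simp add: g_def M.smult_assoc1 del: h.hom_finsum)
  qed
  have g_minus: "g (\<ominus>\<^bsub>?V\<^esub> a) = \<ominus>\<^bsub>M\<^esub> g a" if a: "a \<in> carrier ?V" for a
  proof -
    have "\<ominus>\<^bsub>?V\<^esub> a = (\<ominus>\<^bsub>R\<^esub> \<one>\<^bsub>R\<^esub>) \<odot>\<^bsub>?V\<^esub> a"
      using a V.smult_l_minus[of "\<one>\<^bsub>R\<^esub>" a] V.smult_one[of a] by simp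
    then show ?thesis
      using a g_smult[of "\<ominus>\<^bsub>R\<^esub> \<one>\<^bsub>R\<^esub>" a] g_closed[OF a] M.smult_l_minus[of "\<one>\<^bsub>S\<^esub>" "g a"] by simp
  qed
  \<comment> \<open>The kernel of \<open>g\<close> is a submodule containing \<open>X\<close>, so it
    contains every relation.\<close>
  let ?K = "{a \<in> carrier ?V. g a = \<zero>\<^bsub>M\<^esub>}"
  have "submodule ?K R ?V"
  proof (rule V.submoduleI)
    have "g (\<zero>\<^bsub>R\<^esub> \<odot>\<^bsub>?V\<^esub> \<zero>\<^bsub>?V\<^esub>) = \<phi> \<zero>\<^bsub>R\<^esub> \<odot>\<^bsub>M\<^esub> g \<zero>\<^bsub>?V\<^esub>"
      using V.zero_closed by (intro g_smult) auto
    then show "\<zero>\<^bsub>?V\<^esub> \<in> ?K"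
      using V.zero_closed g_closed V.smult_r_null[of "\<zero>\<^bsub>R\<^esub>"] by simp
  next
    fix a assume "a \<in> ?K"
    then show "\<ominus>\<^bsub>?V\<^esub> a \<in> ?K"
      using g_minus V.a_inv_closed by (simp del: carrier_free_module)
  next
    fix a b assume "a \<in> ?K" "b \<in> ?K"
    then show "a \<oplus>\<^bsub>?V\<^esub> b \<in> ?K"
      using g_add V.a_closed by (simp del: carrier_free_module)
  next
    fix r a assume "r \<in> carrier R" "a \<in> ?K"
    then show "r \<odot>\<^bsub>?V\<^esub> a \<in> ?K"
      using g_smult V.smult_closed by (simp del: carrier_free_module)
  qed auto
  moreover have "X \<subseteq> ?K"
    using X Xz by (auto simp: g_def ann_def)
  ultimately have ker_K: "gen_submodule R ?V X \<subseteq> ?K"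
    by (auto simp: gen_submodule_def)
  have g_eq: "g a = g b" if a: "a \<in> carrier ?V" and b: "b \<in> carrier ?V"
    and ab: "L.lincomb a x n = L.lincomb b x n" for a b
  proof -
    \<comment> \<open>Two coordinate vectors of the same element differ by a relation. The
      difference is written with the scalar minus one so that linearity of \<open>g\<close> and of
      \<open>L.lincomb\<close> applies directly.\<close>
    let ?d = "a \<oplus>\<^bsub>?V\<^esub> (\<ominus>\<^bsub>R\<^esub> \<one>\<^bsub>R\<^esub>) \<odot>\<^bsub>?V\<^esub> b"
    have mb: "(\<ominus>\<^bsub>R\<^esub> \<one>\<^bsub>R\<^esub>) \<odot>\<^bsub>?V\<^esub> b \<in> carrier ?V"
      using b by (intro V.smult_closed) auto
    have lb: "L.lincomb b x n \<in> carrier L"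
      using gen b by blast
    have "L.lincomb ?d x n = L.lincomb b x n \<oplus>\<^bsub>L\<^esub> (\<ominus>\<^bsub>R\<^esub> \<one>\<^bsub>R\<^esub>) \<odot>\<^bsub>L\<^esub> L.lincomb b x n"
      using a b mb x ab L.lincomb_free_add[OF a mb x]
        L.lincomb_free_smult[of "\<ominus>\<^bsub>R\<^esub> \<one>\<^bsub>R\<^esub>" b n x] by (simp del: carrier_free_module)
    also have "\<dots> = \<zero>\<^bsub>L\<^esub>"
      using lb by (simp add: L.smult_l_minus L.M.r_neg)
    finally have "?d \<in> gen_submodule R ?V X"
      using ker V.a_closed[OF a mb] by blast
    then have "g ?d = \<zero>\<^bsub>M\<^esub>"
      using ker_K by blast
    moreover have "g ?d = g a \<oplus>\<^bsub>M\<^esub> \<ominus>\<^bsub>M\<^esub> g b"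
      using g_add[OF a mb] g_smult[of "\<ominus>\<^bsub>R\<^esub> \<one>\<^bsub>R\<^esub>" b] b g_closed[OF b]
      by (simp add: M.smult_l_minus)
    ultimately show ?thesis
      using g_closed[OF a] g_closed[OF b]
      by (metis M.M.add.inv_closed M.M.minus_equality M.M.minus_minus)
  qed
  \<comment> \<open>Coordinates are chosen arbitrarily; \<open>g_eq\<close> makes the value
    independent of the choice.\<close>
  define f where "f = (\<lambda>y\<in>carrier L. g (SOME a. a \<in> carrier ?V \<and> L.lincomb a x n = y))"
  have f_lincomb: "f (L.lincomb a x n) = g a" if a: "a \<in> carrier ?V" for a
  proof -
    let ?b = "SOME b. b \<in> carrier ?V \<and> L.lincomb b x n = L.lincomb a x n"
    have "?b \<in> carrier ?V \<and> L.lincomb ?b x n = L.lincomb a x n"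
      by (rule someI[of _ a]) (intro conjI a refl)
    then have "g ?b = g a"
      by (intro g_eq a) (elim conjE, assumption)+
    moreover have "L.lincomb a x n \<in> carrier L"
      using gen a by blast
    ultimately show ?thesis
      by (simp add: f_def)
  qed
  have coords: "\<exists>a\<in>carrier ?V. y = L.lincomb a x n" if "y \<in> carrier L" for y
    using gen that by blast
  have f_hom: "f \<in> module_hom R L (restrict_scalars \<phi> M)"
    unfolding module_hom_def
  proof (intro CollectI conjI ballI)
    have "f y \<in> carrier M" if "y \<in> carrier L" for y
      using coords[OF that] f_lincomb g_closed by auto
    then show "f \<in> carrier L \<rightarrow>\<^sub>E carrier (restrict_scalars \<phi> M)"
      by (auto simp: restrict_scalars_def f_def)
  next
    fix y y' assume y: "y \<in> carrier L" "y' \<in> carrier L"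
    obtain a b where a: "a \<in> carrier ?V" "y = L.lincomb a x n"
      and b: "b \<in> carrier ?V" "y' = L.lincomb b x n"
      using coords y by blast
    have "f (y \<oplus>\<^bsub>L\<^esub> y') = g (a \<oplus>\<^bsub>?V\<^esub> b)"
      unfolding a(2) b(2) using a(1) b(1) x
      by (subst L.lincomb_free_add[symmetric]) (auto simp del: carrier_free_module intro!: f_lincomb)
    then show "f (y \<oplus>\<^bsub>L\<^esub> y') = f y \<oplus>\<^bsub>restrict_scalars \<phi> M\<^esub> f y'"
      using a b f_lincomb g_add by (simp add: restrict_scalars_def)
  next
    fix r y assume r: "r \<in> carrier R" and y: "y \<in> carrier L"
    obtain a where a: "a \<in> carrier ?V" "y = L.lincomb a x n"
      using coords y by blast
    have "f (r \<odot>\<^bsub>L\<^esub> y) = g (r \<odot>\<^bsub>?V\<^esub> a)"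
      unfolding a(2) using a(1) r x
      by (subst L.lincomb_free_smult[symmetric]) (auto simp del: carrier_free_module intro!: f_lincomb)
    then show "f (r \<odot>\<^bsub>L\<^esub> y) = r \<odot>\<^bsub>restrict_scalars \<phi> M\<^esub> f y"
      using a r f_lincomb g_smult by (simp add: restrict_scalars_def)
  qed
  have "ann S M z \<subseteq> ann S (Hom_module R \<phi> L M) f"
  proof
    fix s assume "s \<in> ann S M z"
    then have s: "s \<in> carrier S" "s \<odot>\<^bsub>M\<^esub> z = \<zero>\<^bsub>M\<^esub>"
      by (auto simp: ann_def)
    have "s \<odot>\<^bsub>M\<^esub> g a = \<zero>\<^bsub>M\<^esub>" if a: "a \<in> carrier ?V" for a
      unfolding g_def using dot_closed[OF a] s z
      by (subst M.smult_left_commute) (auto simp del: h.hom_finsum)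
    then have "s \<odot>\<^bsub>M\<^esub> f y = \<zero>\<^bsub>M\<^esub>" if "y \<in> carrier L" for y
      using coords[OF that] f_lincomb by auto
    then show "s \<in> ann S (Hom_module R \<phi> L M) f"
      using s by (simp add: ann_Hom_module)
  qed
  moreover have "ann S (Hom_module R \<phi> L M) f \<subseteq> P"
  proof
    fix s assume "s \<in> ann S (Hom_module R \<phi> L M) f"
    then have s: "s \<in> carrier S" and sf: "s \<odot>\<^bsub>M\<^esub> f (x k) = \<zero>\<^bsub>M\<^esub>"
      using x k by (auto simp: ann_Hom_module)
    \<comment> \<open>The unit vector at \<open>k\<close> gives coordinates for \<open>x k\<close>,
      so \<open>f (x k)\<close> is \<open>\<phi> (w k)\<close> times \<open>z\<close>. Thus
      \<open>s\<close> times \<open>\<phi> (w k)\<close> kills \<open>z\<close> and lies in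
      \<open>P\<close>, and primality leaves \<open>s \<in> P\<close>.\<close>
    let ?e = "\<lambda>i\<in>{..<n}. if i = k then \<one>\<^bsub>R\<^esub> else \<zero>\<^bsub>R\<^esub>"
    have e: "?e \<in> carrier ?V"
      by auto
    have "L.lincomb ?e x n = L.lincomb (\<lambda>i. if i = k then \<one>\<^bsub>R\<^esub> else \<zero>\<^bsub>R\<^esub>) x n"
      using x by (intro L.lincomb_cong) auto
    also have "\<dots> = x k"
      using k x by (intro L.lincomb_delta) auto
    finally have "f (x k) = g ?e"
      using f_lincomb[OF e] by simp
    moreover have "(\<Oplus>\<^bsub>R\<^esub>i\<in>{..<n}. w i \<otimes>\<^bsub>R\<^esub> ?e i) = w k"
    proof -
      have "(\<Oplus>\<^bsub>R\<^esub>i\<in>{..<n}. w i \<otimes>\<^bsub>R\<^esub> ?e i) = (\<Oplus>\<^bsub>R\<^esub>i\<in>{..<n}. if k = i then w i else \<zero>\<^bsub>R\<^esub>)"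
        using wc by (intro L.R.finsum_cong') auto
      also have "\<dots> = w k"
        using k wc by (intro L.R.finsum_singleton) auto
      finally show ?thesis .
    qed
    ultimately have "s \<odot>\<^bsub>M\<^esub> (\<phi> (w k) \<odot>\<^bsub>M\<^esub> z) = \<zero>\<^bsub>M\<^esub>"
      using sf by (simp only: g_def)
    then have "s \<otimes>\<^bsub>S\<^esub> \<phi> (w k) \<in> ann S M z"
      using s wc z by (simp add: ann_def M.smult_assoc1)
    then show "s \<in> P"
      using z(2) P.I_prime[of s "\<phi> (w k)"] s wc k(2) by auto
  qed
  ultimately show ?thesis
    using f_hom by auto
qed

theorem theorem5p3:
  fixes R :: "('r, 'x) ring_scheme"
    and S :: "('s, 'y) ring_scheme"
    and \<phi> :: "'r \<Rightarrow> 's"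
    and L :: "('r, 'l, 'z) module_scheme"
    and M :: "('s, 'm, 'w) module_scheme"
  assumes "cring R" and "cring S"
    and "\<phi> \<in> ring_hom R S"
    and "module R L" and "fin_presented R L"
    and "module S M"
  shows "sK S (Hom_module R \<phi> L M) =
    {P \<in> Spec S. Spec_map R \<phi> P \<in> Supp R L} \<inter> sK S M"
proof (intro subset_antisym subsetI)
  interpret L: module R L by fact
  interpret M: module S M by fact
  interpret h: ring_hom_cring R S \<phi>
    by unfold_locales fact
  let ?H = "Hom_module R \<phi> L M"
  obtain n x X where x: "x \<in> {..<n} \<rightarrow> carrier L"
    and gen: "(\<lambda>a. L.lincomb a x n) ` carrier (free_module R n) = carrier L"
    and X: "finite X" "X \<subseteq> carrier (free_module R n)"
    and ker: "{a \<in> carrier (free_module R n). L.lincomb a x n = \<zero>\<^bsub>L\<^esub>} = gen_submodule R (free_module R n) X"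
    using L.fin_presented_generators[OF \<open>fin_presented R L\<close>] .
  fix P
  {
    assume P: "P \<in> sK S ?H"
    then have P_Spec: "P \<in> Spec S"
      by (simp add: sK_def)
    then have prime: "primeideal P S"
      by (simp add: Spec_def)
    interpret P: primeideal P S by fact
    have p_Spec: "Spec_map R \<phi> P \<in> Spec R"
      using assms P_Spec by (intro Spec_map_Spec)
    \<comment> \<open>The annihilator of \<open>f\<close> lies in that of each of its values, and at
      some generator the latter is still inside \<open>P\<close>. The index \<open>k\<close> may
      vary with \<open>I\<close>, which the definition of \<open>sK\<close> permits.\<close>
    have key: "\<exists>k<n. I \<subseteq> ann S M (f (x k)) \<and> ann S M (f (x k)) \<subseteq> P \<and> f (x k) \<in> carrier M"
      if f: "f \<in> carrier ?H" "I \<subseteq> ann S ?H f" "ann S ?H f \<subseteq> P" for I f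
    proof -
      obtain k where k: "k < n" "ann S M (f (x k)) \<subseteq> P"
        using ann_Hom_module_subset_prime[OF assms(3,4,6) prime x gen f(1,3)] by blast
      moreover have "x k \<in> carrier L"
        using k x by auto
      moreover from this have "ann S ?H f \<subseteq> ann S M (f (x k))"
        unfolding ann_Hom_module by (auto simp: ann_def)
      moreover have "f (x k) \<in> carrier M"
        using module_homD(1)[OF f(1)[simplified]] \<open>x k \<in> carrier L\<close>
        by (auto simp: restrict_scalars_def)
      ultimately show ?thesis
        using f(2) by blast
    qed
    have hom: "\<exists>f\<in>carrier ?H. I \<subseteq> ann S ?H f \<and> ann S ?H f \<subseteq> P"
      if "fin_gen_ideal S I" "I \<subseteq> P" for I
      using P that unfolding sK_def by blast
    have "P \<in> sK S M"
      unfolding sK_def using P_Spec hom key by blast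
    moreover have "Spec_map R \<phi> P \<in> Supp R L"
    proof (rule ccontr)
      assume no: "Spec_map R \<phi> P \<notin> Supp R L"
      \<comment> \<open>The zero ideal is finitely generated and lies in \<open>P\<close>; applying
        \<open>hom\<close> to it produces some \<open>f\<close> and a generator \<open>x k\<close>
        with the annihilator of \<open>f (x k)\<close> inside \<open>P\<close>.\<close>
      have "fin_gen_ideal S (Idl\<^bsub>S\<^esub> {})"
        unfolding fin_gen_ideal_def by blast
      moreover have "Idl\<^bsub>S\<^esub> {} \<subseteq> P"
        by (intro M.R.genideal_minimal P.is_ideal) auto
      ultimately obtain f k where k: "k < n" "ann S M (f (x k)) \<subseteq> P" and f: "f \<in> carrier ?H"
        using hom key by metis
      have xk: "x k \<in> carrier L"
        using k x by auto
      \<comment> \<open>Since \<open>u\<close> kills \<open>x k\<close>, its image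
        \<open>\<phi> u\<close> kills \<open>f (x k)\<close> and so lies in \<open>P\<close>,
        although \<open>u\<close> is outside the contraction of \<open>P\<close>.\<close>
      obtain u where u: "u \<in> carrier R - Spec_map R \<phi> P" "u \<odot>\<^bsub>L\<^esub> x k = \<zero>\<^bsub>L\<^esub>"
        using L.not_Supp_annihilated[OF p_Spec no xk] by blast
      have f_smult: "f (r \<odot>\<^bsub>L\<^esub> y) = \<phi> r \<odot>\<^bsub>M\<^esub> f y" if "r \<in> carrier R" "y \<in> carrier L" for r y
        using module_homD(3)[OF f[simplified] that] by (simp add: restrict_scalars_def)
      have "f \<zero>\<^bsub>L\<^esub> \<in> carrier M"
        using module_homD(1)[OF f[simplified]] by (auto simp: restrict_scalars_def)
      then have "f \<zero>\<^bsub>L\<^esub> = \<zero>\<^bsub>M\<^esub>"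
        using f_smult[of "\<zero>\<^bsub>R\<^esub>" "\<zero>\<^bsub>L\<^esub>"] by simp
      then have "\<phi> u \<in> ann S M (f (x k))"
        using f_smult[of u "x k"] u xk by (simp add: ann_def)
      then show False
        using k u by (auto simp: Spec_map_def)
    qed
    ultimately show "P \<in> {P \<in> Spec S. Spec_map R \<phi> P \<in> Supp R L} \<inter> sK S M"
      using P_Spec by blast
  }
  {
    assume "P \<in> {P \<in> Spec S. Spec_map R \<phi> P \<in> Supp R L} \<inter> sK S M"
    then have P_Spec: "P \<in> Spec S" and supp: "Spec_map R \<phi> P \<in> Supp R L" and P: "P \<in> sK S M"
      by auto
    then have prime: "primeideal P S"
      by (simp add: Spec_def)
    interpret P: primeideal P S by fact
    let ?p = "Spec_map R \<phi> P"
    have p_prime: "primeideal ?p R"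
      using supp by (simp add: Supp_def Spec_def)
    \<comment> \<open>An element killing all generators would kill \<open>L\<close>, against the
      support condition.\<close>
    have "\<exists>k<n. v \<odot>\<^bsub>L\<^esub> x k \<noteq> \<zero>\<^bsub>L\<^esub>" if v: "v \<in> carrier R - ?p" for v
    proof (rule ccontr)
      assume *: "\<not> ?thesis"
      have "v \<odot>\<^bsub>L\<^esub> L.lincomb a x n = \<zero>\<^bsub>L\<^esub>" if a: "a \<in> carrier (free_module R n)" for a
      proof -
        have "v \<odot>\<^bsub>L\<^esub> L.lincomb a x n = (\<Oplus>\<^bsub>L\<^esub>i\<in>{..<n}. v \<odot>\<^bsub>L\<^esub> (a i \<odot>\<^bsub>L\<^esub> x i))"
          using v a x by (intro L.finsum_smult_ldistr) auto
        also have "\<dots> = \<zero>\<^bsub>L\<^esub>"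
        proof (rule L.M.add.finprod_one_eqI)
          fix i assume i: "i \<in> {..<n}"
          then have "v \<odot>\<^bsub>L\<^esub> (a i \<odot>\<^bsub>L\<^esub> x i) = a i \<odot>\<^bsub>L\<^esub> (v \<odot>\<^bsub>L\<^esub> x i)"
            using v a x by (intro L.smult_left_commute) auto
          also have "\<dots> = \<zero>\<^bsub>L\<^esub>"
            using * i a by (auto simp: PiE_iff)
          finally show "v \<odot>\<^bsub>L\<^esub> (a i \<odot>\<^bsub>L\<^esub> x i) = \<zero>\<^bsub>L\<^esub>" .
        qed
        finally show ?thesis .
      qed
      then show False
        using L.Supp_not_annihilated[OF supp v] unfolding gen[symmetric] by blast
    qed
    then obtain w k where w: "w \<in> UNIV \<rightarrow> carrier R" and k: "k < n" "w k \<notin> ?p"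
      and wp: "\<forall>a\<in>{..<n} \<rightarrow> carrier R. L.lincomb a x n = \<zero>\<^bsub>L\<^esub> \<longrightarrow>
        (\<Oplus>\<^bsub>R\<^esub>i\<in>{..<n}. w i \<otimes>\<^bsub>R\<^esub> a i) \<in> ?p"
      using L.exists_functional_mod_prime[OF p_prime x] by blast
    \<comment> \<open>The finitely many obstructions to \<open>w\<close> defining a map into the
      multiples of some \<open>z\<close>. They lie in \<open>P\<close> because the elements of
      \<open>X\<close> are relations, which \<open>w\<close> sends into \<open>?p\<close>.\<close>
    define Z where "Z = (\<lambda>a. \<phi> (\<Oplus>\<^bsub>R\<^esub>i\<in>{..<n}. w i \<otimes>\<^bsub>R\<^esub> a i)) ` X"
    have Z: "Z \<subseteq> P"
    proof -
      have "X \<subseteq> gen_submodule R (free_module R n) X"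
        by (auto simp: gen_submodule_def)
      then have "a \<in> {..<n} \<rightarrow> carrier R \<and> L.lincomb a x n = \<zero>\<^bsub>L\<^esub>" if "a \<in> X" for a
        using ker that by (auto dest: PiE_mem)
      then show ?thesis
        using wp by (auto simp: Z_def Spec_map_def)
    qed
    have "\<exists>f\<in>carrier ?H. I \<subseteq> ann S ?H f \<and> ann S ?H f \<subseteq> P"
      if "fin_gen_ideal S I" "I \<subseteq> P" for I
    proof -
      obtain Y where Y: "finite Y" "Y \<subseteq> carrier S" "I = Idl\<^bsub>S\<^esub> Y"
        using \<open>fin_gen_ideal S I\<close> by (auto simp: fin_gen_ideal_def)
      \<comment> \<open>Adjoining \<open>Z\<close> keeps the ideal finitely generated and inside
        \<open>P\<close>; a \<open>z\<close> killed by \<open>?J\<close> is killed by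
        \<open>I\<close> and by every obstruction at once.\<close>
      let ?J = "Idl\<^bsub>S\<^esub> (Y \<union> Z)"
      have YZ: "Y \<union> Z \<subseteq> carrier S"
        using Y(2) Z P.a_subset by blast
      have YP: "Y \<subseteq> P"
        using M.R.genideal_self[OF Y(2)] \<open>I \<subseteq> P\<close> Y(3) by blast
      have J: "Y \<union> Z \<subseteq> ?J"
        using M.R.genideal_self[OF YZ] .
      have IJ: "I \<subseteq> ?J"
        unfolding Y(3) using J YZ by (intro M.R.genideal_minimal M.R.genideal_ideal) auto
      have "fin_gen_ideal S ?J"
        unfolding fin_gen_ideal_def using X(1) Y(1) YZ by (intro exI[of _ "Y \<union> Z"]) (auto simp: Z_def)
      moreover have "?J \<subseteq> P"
        using YP Z by (intro M.R.genideal_minimal P.is_ideal) auto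
      ultimately obtain z where z: "z \<in> carrier M" "?J \<subseteq> ann S M z" "ann S M z \<subseteq> P"
        using P unfolding sK_def by blast
      have wk: "\<phi> (w k) \<notin> P"
        using k w by (auto simp: Spec_map_def)
      have "\<phi> (\<Oplus>\<^bsub>R\<^esub>i\<in>{..<n}. w i \<otimes>\<^bsub>R\<^esub> a i) \<in> ann S M z" if "a \<in> X" for a
        using that J z(2) unfolding Z_def by blast
      from exists_hom_with_ann[OF assms(3,4,6) prime x gen X(2) ker w k(1) wk z(1,3) this]
      show ?thesis
        using IJ z(2) by blast
    qed
    then show "P \<in> sK S ?H"
      using P_Spec by (simp add: sK_def)
  }
qed

end
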